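(* Let $\Delta_1=\{0,v_1,\dots,v_k\}$ and $\Delta_2=\{0,u_1,\dots,u_k\}$ be two $k$-simplicial sets in $(2\mathbb{Z})^n$. There exists $T\in\mathcal{M}_n$ with $b_T=0$ such that $$T(\Delta_1)^*=\Delta_2^*$$ if and only if the lattices $L_{\Delta_1}$ and $L_{\Delta_2}$ share the same Hermite normal form up to a permutation of columns.
   Context: A finite set $\Delta\subset(2\mathbb{Z})^n$ is called $k$-simplicial if $\operatorname{conv}(\Delta)\subset\mathbb{R}^n$ is a $k$-simplex with vertex set $\Delta$, i.e. $\Delta$ consists of $k+1$ affinely independent points with all coordinates even integers. For $L\subseteq\mathbb{Z}^n$ put $\operatorname{Mid}(L)=\{\tfrac{s+t}{2} : s,t\in L\cap(2\mathbb{Z})^n,\ s\neq t\}$. For a finite set $\Delta\subset(2\mathbb{Z})^n$, a set $L\subseteq\mathbb{Z}^n$ is $\Delta$-mediated if $\Delta\subseteq L\subseteq\operatorname{Mid}(L)\cup\Delta$. The maximal $\Delta$-mediated set $\Delta^*$ is the (unique, existing) $\Delta$-mediated set containing every $\Delta$-mediated set; it satisfies $\Delta\cup\operatorname{Mid}(\Delta)\subseteq\Delta^*\subseteq\operatorname{conv}(\Delta)\cap\mathbb{Z}^n$. A function $T:\mathbb{R}^n\to\mathbb{R}^n$ is called maximal mediated set preserving if for every $k$ and every $k$-simplicial set $\Delta\subseteq(2\mathbb{Z})^n$: (1) $T(\Delta)\subseteq(2\mathbb{Z})^n$ is a $k$-simplicial set; (2) for every $q\in T(\Delta)^*$ there exists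 a unique $p\in\Delta^*$ with $T(p)=q$; (3) for every $q\in\operatorname{conv}(T(\Delta))\cap\mathbb{Z}^n$ there exists a unique $p\in\operatorname{conv}(\Delta)\cap\mathbb{Z}^n$ with $T(p)=q$. $\mathcal{M}_n$ is the group (under composition) of all maps $T(x)=A_Tx+b_T$ with $A_T\in\mathbb{Z}^{n\times n}$, $\det A_T=\pm1$, $b_T\in(2\mathbb{Z})^n$, that are maximal mediated set preserving. For a $k$-simplicial set $\Delta=\{0,v_1,\dots,v_k\}\subset(2\mathbb{Z})^n$ (vertices listed in some fixed order), the lattice $L_\Delta\subset\mathbb{Z}^k$ is the one generated over $\mathbb{Z}$ by the rows of the $n\times k$ integer matrix $M_\Delta=[v_1\ \cdots\ v_k]$ with columns $v_1,\dots,v_k$. The Hermite normal form of $L_\Delta$ is the row Hermite normal form of this matrix (the canonical form under left multiplication by $\operatorname{GL}(\mathbb{Z}^n)$). "$L_{\Delta_1}$ and $L_{\Delta_2}$ share the same Hermite normal form up to a permutation of columns" means that, for some permutation of the columns of $M_{\Delta_1}$ (i.e. some reordering of the nonzero vertices of $\Delta_1$), the resulting matrix has the same row Hermite normal form as $M_{\Delta_2}$; equivalently, $L_{\Delta_1}$ and $L_{\Delta_2}$ coincide after a permutation of the coordinates of $\mathbb{Z}^k$.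
   Formalization: Mediated sets L are required to be finite; with arbitrary L ⊆ Z^n the set Z^n itself is Δ-mediated, so Δ* = Z^n, contradicting Δ* ⊆ conv(Δ) and making the claim false (n=1, {0,2} and {0,4}). *)

theory Defs
  imports "HOL-Analysis.Analysis" "HOL-Combinatorics.Permutations"
begin

definition integer_points :: "(real ^ 'n) set" where
  "integer_points = {x. \<forall>i. x $ i \<in> \<int>}"

definition even_points :: "(real ^ 'n) set" where
  "even_points = {x. \<forall>i. \<exists>m::int. x $ i = 2 * of_int m}"

definition k_simplicial :: "nat \<Rightarrow> (real ^ 'n) set \<Rightarrow> bool" where
  "k_simplicial k \<Delta> \<longleftrightarrow>
     finite \<Delta> \<and> \<Delta> \<subseteq> even_points \<and> \<not> affine_dependent \<Delta> \<and> card \<Delta> = k + 1"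

definition Mid :: "(real ^ 'n) set \<Rightarrow> (real ^ 'n) set" where
  "Mid L = {midpoint s t | s t. s \<in> L \<inter> even_points \<and> t \<in> L \<inter> even_points \<and> s \<noteq> t}"

text \<open>
  Mediated sets are finite by convention. Without finiteness the set of all integer points
  would be mediated with respect to every \<open>\<Delta>\<close>, and the maximal mediated set would not be
  contained in the convex hull of \<open>\<Delta>\<close>. The extreme points of a finite mediated set
  belong to \<open>\<Delta>\<close>, so that finite mediated sets do lie in the convex hull of \<open>\<Delta>\<close>.
\<close>

definition mediated :: "(real ^ 'n) set \<Rightarrow> (real ^ 'n) set \<Rightarrow> bool" where
  "mediated \<Delta> L \<longleftrightarrow>
     finite L \<and> L \<subseteq> integer_points \<and> \<Delta> \<subseteq> L \<and> L \<subseteq> Mid L \<union> \<Delta>"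

definition max_mediated :: "(real ^ 'n) set \<Rightarrow> (real ^ 'n) set" where
  "max_mediated \<Delta> = (THE L. mediated \<Delta> L \<and> (\<forall>L'. mediated \<Delta> L' \<longrightarrow> L' \<subseteq> L))"

definition mms_preserving :: "(real ^ 'n \<Rightarrow> real ^ 'n) \<Rightarrow> bool" where
  "mms_preserving T \<longleftrightarrow>
     (\<forall>k \<Delta>. k_simplicial k \<Delta> \<longrightarrow>
        k_simplicial k (T ` \<Delta>) \<and>
        (\<forall>q \<in> max_mediated (T ` \<Delta>). \<exists>!p. p \<in> max_mediated \<Delta> \<and> T p = q) \<and>
        (\<forall>q \<in> convex hull (T ` \<Delta>) \<inter> integer_points.
           \<exists>!p. p \<in> convex hull \<Delta> \<inter> integer_points \<and> T p = q))"

definition unimodular :: "real ^ 'n ^ 'n \<Rightarrow> bool" where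
  "unimodular A \<longleftrightarrow> (\<forall>i j. A $ i $ j \<in> \<int>) \<and> (det A = 1 \<or> det A = -1)"

definition mms_group :: "(real ^ 'n \<Rightarrow> real ^ 'n) set" where
  "mms_group = {T. mms_preserving T \<and>
     (\<exists>A b. unimodular A \<and> b \<in> even_points \<and> T = (\<lambda>x. A *v x + b))}"

text \<open>The vector \<open>b\<close> of an affine map \<open>x \<mapsto> A *v x + b\<close> is its value at the origin.\<close>

definition translation_part :: "(real ^ 'n \<Rightarrow> real ^ 'n) \<Rightarrow> real ^ 'n" where
  "translation_part T = T 0"

text \<open>
  A matrix with \<open>n\<close> rows and \<open>k\<close> columns is the list of its \<open>k\<close> columns, so the entry in
  row \<open>i\<close> and column \<open>j\<close> of \<open>M\<close> is \<open>M ! j $ i\<close>, and columns are numbered from \<open>0\<close>. The matrix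
  of a simplicial set is thus the list of its nonzero vertices. Left multiplication by \<open>U\<close>
  applies \<open>(*v) U\<close> to every column. The rows are indexed by a finite linearly ordered type,
  since the echelon form depends on the order of the rows.
\<close>

definition pivot :: "(real ^ 'n) list \<Rightarrow> 'n \<Rightarrow> nat \<Rightarrow> bool" where
  "pivot M i j \<longleftrightarrow> j < length M \<and> M ! j $ i \<noteq> 0 \<and> (\<forall>l<j. M ! l $ i = 0)"

text \<open>
  Integer row echelon form with zero rows at the bottom and pivots moving strictly to the
  right, where pivots are positive and the entries above a pivot \<open>d\<close> lie in \<open>{0..<d}\<close>.
\<close>

definition is_row_hermite :: "(real ^ 'n::{finite,linorder}) list \<Rightarrow> bool" where
  "is_row_hermite H \<longleftrightarrow>
     set H \<subseteq> integer_points \<and>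
     (\<forall>i i' j'. i < i' \<and> pivot H i' j' \<longrightarrow> (\<exists>j<j'. pivot H i j)) \<and>
     (\<forall>i j. pivot H i j \<longrightarrow>
        H ! j $ i > 0 \<and> (\<forall>i'<i. 0 \<le> H ! j $ i' \<and> H ! j $ i' < H ! j $ i))"

definition hermite_normal_form ::
    "(real ^ 'n::{finite,linorder}) list \<Rightarrow> (real ^ 'n::{finite,linorder}) list" where
  "hermite_normal_form M =
     (THE H. is_row_hermite H \<and> (\<exists>U. unimodular U \<and> H = map ((*v) U) M))"

end

theory Submission
  imports Defs
begin

text \<open>
  Both sides of the equivalence say that some unimodular matrix maps the nonzero vertices of one
  simplex onto those of the other.

  On the geometric side, a map in the group that fixes the origin is given by a unimodular
  matrix, and conversely every unimodular matrix belongs to the group, because it permutes the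
  integer points and respects parity, midpoints and convex hulls
  (\<open>unimodular_in_mms_group\<close>). The condition on maximal mediated sets amounts to equality of the
  simplicial sets themselves. Indeed, a maximal mediated set lies between the vertices and their
  convex hull, and so the vertices are the extreme points of its hull (\<open>max_mediated_inj\<close>). A
  bijection between the nonzero vertices is the same as a permutation of the columns.

  On the arithmetic side, two integer matrices have the same Hermite normal form exactly if
  they differ by a unimodular factor on the left (\<open>hermite_normal_form_eq_iff\<close>). This is because
  the normal form exists (\<open>row_hermite_exists\<close>), by a column-by-column Euclidean reduction, and is
  unique (\<open>row_hermite_unique\<close>), since the pivots are the leading entries of least absolute value
  in the lattice spanned by the rows and the other entries are then fixed as remainders.

  Unimodular matrices are handled as the linear maps that carry the integer points onto
  themselves (\<open>unimodular_iff_integer_points\<close>), so that composition, inversion and row operations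
  need no determinants.
\<close>

section \<open>Integer points and unimodular matrices\<close>

lemma even_points_eq_scaled_integer_points: "even_points = (*\<^sub>R) 2 ` integer_points"
proof (intro set_eqI iffI)
  fix x :: "real ^ 'n" assume "x \<in> even_points"
  then have "\<forall>i. \<exists>m::int. x $ i = 2 * of_int m" by (simp add: even_points_def)
  then obtain m :: "'n \<Rightarrow> int" where m: "\<And>i. x $ i = 2 * of_int (m i)" by metis
  have "x = 2 *\<^sub>R (\<chi> i. of_int (m i))" by (simp add: vec_eq_iff m)
  moreover have "(\<chi> i. of_int (m i)) \<in> (integer_points :: (real ^ 'n) set)"
    by (simp add: integer_points_def)
  ultimately show "x \<in> (*\<^sub>R) 2 ` integer_points" by blast
next
  fix x :: "real ^ 'n" assume "x \<in> (*\<^sub>R) 2 ` integer_points"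
  then show "x \<in> even_points" by (auto simp: even_points_def integer_points_def) (metis Ints_cases)
qed

lemma even_points_subset_integer_points: "even_points \<subseteq> integer_points"
  by (auto simp: even_points_eq_scaled_integer_points integer_points_def)

lemma finite_bounded_integer_points:
  fixes S :: "(real ^ 'n) set"
  assumes "bounded S"
  shows "finite (S \<inter> integer_points)"
proof -
  obtain B where B: "\<And>x. x \<in> S \<Longrightarrow> norm x \<le> B" using assms by (auto simp: bounded_iff)
  let ?F = "(UNIV :: 'n set) \<rightarrow>\<^sub>E {- \<lceil>B\<rceil>..\<lceil>B\<rceil>}"
  have "S \<inter> integer_points \<subseteq> (\<lambda>f. \<chi> i. of_int (f i)) ` ?F"
  proof
    fix x assume x: "x \<in> S \<inter> integer_points"
    have "\<bar>x $ i\<bar> \<le> B" for i using B[of x] x component_le_norm_cart[of x i] by auto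
    then have le: "x $ i \<le> B" "- x $ i \<le> B" for i using abs_le_iff by blast+
    have "x = (\<chi> i. of_int \<lfloor>x $ i\<rfloor>)" using x by (simp add: integer_points_def vec_eq_iff)
    moreover have "(\<lambda>i. \<lfloor>x $ i\<rfloor>) \<in> ?F"
    proof (rule PiE_I)
      fix i
      obtain m where "x $ i = of_int m" using x by (auto simp: integer_points_def elim: Ints_cases)
      then show "\<lfloor>x $ i\<rfloor> \<in> {- \<lceil>B\<rceil>..\<lceil>B\<rceil>}" using le[of i] by simp linarith
    qed simp
    ultimately show "x \<in> (\<lambda>f. \<chi> i. of_int (f i)) ` ?F" by (rule image_eqI)
  qed
  then show ?thesis by (rule finite_subset) (simp add: finite_PiE)
qed

lemma det_in_Ints:
  fixes A :: "real ^ 'n ^ 'n"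
  assumes "\<And>i j. A $ i $ j \<in> \<int>"
  shows "det A \<in> \<int>"
  unfolding det_def using assms by (intro Ints_sum Ints_mult Ints_prod) auto

text \<open>
  Cramer's rule expresses the preimage of an integer vector as a quotient of an integer by the
  determinant. Conversely, integer preimages of the unit vectors are the columns of an integer
  inverse, and two integers with product one are both units.
\<close>

lemma unimodular_iff_integer_points:
  fixes A :: "real ^ 'n ^ 'n"
  shows "unimodular A \<longleftrightarrow> (*v) A ` integer_points = integer_points"
proof
  assume A: "unimodular A"
  have "A *v x \<in> integer_points" if "x \<in> integer_points" for x
    using that A unfolding integer_points_def unimodular_def
    by (auto simp: matrix_vector_mult_def)
  moreover have "\<exists>x\<in>integer_points. A *v x = y" if y: "y \<in> integer_points" for y
  proof -
    have d: "det A \<noteq> 0" using A by (auto simp: unimodular_def)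
    define x where "x = (\<chi> k. det (\<chi> i j. if j = k then y $ i else A $ i $ j) / det A)"
    have "x \<in> integer_points"
      unfolding integer_points_def x_def
    proof (intro CollectI allI)
      fix k
      have "det (\<chi> i j. if j = k then y $ i else A $ i $ j) \<in> \<int>"
        using A y by (intro det_in_Ints) (auto simp: unimodular_def integer_points_def)
      then show "(\<chi> k. det (\<chi> i j. if j = k then y $ i else A $ i $ j) / det A) $ k \<in> \<int>"
        using A by (auto simp: unimodular_def)
    qed
    moreover have "A *v x = y" using cramer[OF d, of x y] x_def by simp
    ultimately show ?thesis by blast
  qed
  ultimately show "(*v) A ` integer_points = integer_points" by blast
next
  assume A: "(*v) A ` integer_points = integer_points"
  have axis: "axis j 1 \<in> integer_points" for j :: 'n
    by (simp add: integer_points_def axis_def)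
  have int: "A $ i $ j \<in> \<int>" for i j
  proof -
    have "A *v axis j 1 \<in> integer_points" using A axis by blast
    then show ?thesis by (simp add: integer_points_def matrix_vector_mult_basis column_def)
  qed
  have "\<exists>w\<in>integer_points. A *v w = axis j 1" for j using A axis[of j] by (metis imageE)
  then obtain w where w: "\<And>j. w j \<in> integer_points" "\<And>j. A *v w j = axis j 1" by metis
  define B where "B = (\<chi> i j. w j $ i)"
  have "column j (A ** B) = axis j 1" for j
    using w(2)[of j]
    by (simp add: B_def column_def matrix_matrix_mult_def matrix_vector_mult_def vec_eq_iff)
  then have "A ** B = mat 1"
    by (auto simp: vec_eq_iff column_def mat_def axis_def)
  then have "det A * det B = 1" by (metis det_mul det_I)
  moreover have "det A \<in> \<int>" "det B \<in> \<int>"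
    using int w(1) by (auto intro!: det_in_Ints simp: B_def integer_points_def)
  then obtain a b :: int where "det A = of_int a" "det B = of_int b" by (metis Ints_cases)
  ultimately have "a * b = 1" "det A = of_int a" by (metis of_int_mult of_int_eq_1_iff)+
  then show "unimodular A" using int by (auto simp: unimodular_def zmult_eq_1_iff)
qed

lemma unimodular_mat_1: "unimodular (mat 1)"
  by (simp add: unimodular_iff_integer_points)

lemma unimodular_mult:
  assumes "unimodular A" "unimodular B"
  shows "unimodular (A ** B)"
proof -
  have "(*v) (A ** B) ` integer_points = (*v) A ` (*v) B ` integer_points"
    by (simp add: image_image matrix_vector_mul_assoc)
  then show ?thesis using assms by (simp add: unimodular_iff_integer_points)
qed

lemma unimodular_inverse:
  fixes A :: "real ^ 'n ^ 'n"
  assumes "unimodular A"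
  obtains B where "unimodular B" "\<And>x. A *v (B *v x) = x" "\<And>x. B *v (A *v x) = x"
proof -
  have "det A \<noteq> 0" using assms by (auto simp: unimodular_def)
  then obtain B where B: "A ** B = mat 1" "B ** A = mat 1"
    by (metis invertible_det_nz invertible_def)
  have inv: "A *v (B *v x) = x" "B *v (A *v x) = x" for x
    by (simp_all add: matrix_vector_mul_assoc B)
  have "(*v) B ` integer_points = (*v) B ` (*v) A ` integer_points"
    using assms by (simp add: unimodular_iff_integer_points)
  also have "\<dots> = integer_points" by (simp add: image_image inv)
  finally show ?thesis using that inv by (simp add: unimodular_iff_integer_points)
qed

lemma inj_unimodular: "unimodular A \<Longrightarrow> inj ((*v) A)"
  by (metis unimodular_inverse injI)

lemma unimodular_in_integer_points:
  "unimodular A \<Longrightarrow> x \<in> integer_points \<Longrightarrow> A *v x \<in> integer_points"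
  by (auto simp: unimodular_iff_integer_points)

lemma unimodular_image_even_points:
  assumes "unimodular A"
  shows "(*v) A ` even_points = even_points"
proof -
  have "(*v) A ` even_points = (*\<^sub>R) 2 ` (*v) A ` integer_points"
    by (simp add: even_points_eq_scaled_integer_points image_image matrix_vector_mult_scaleR)
  then show ?thesis
    using assms by (simp add: unimodular_iff_integer_points even_points_eq_scaled_integer_points)
qed

text \<open>
  This produces unimodular matrices from functions, so that row operations can be given as
  functions and no determinant has to be evaluated.
\<close>

lemma obtain_unimodular:
  fixes f g :: "real ^ 'n \<Rightarrow> real ^ 'n"
  assumes "linear f" "\<And>x. f (g x) = x"
    and "\<And>x. x \<in> integer_points \<Longrightarrow> f x \<in> integer_points"
    and "\<And>x. x \<in> integer_points \<Longrightarrow> g x \<in> integer_points"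
  obtains U where "unimodular U" "\<And>x. U *v x = f x"
proof -
  have eq: "matrix f *v x = f x" for x using matrix_works assms(1)
    by (simp add: linear_matrix_vector_mul_eq)
  have "f ` integer_points = integer_points"
    using assms(2-4) by (metis image_eqI subsetI subset_antisym image_subsetI)
  then have "unimodular (matrix f)" by (simp add: unimodular_iff_integer_points eq)
  then show ?thesis using eq that by blast
qed

section \<open>Maximal mediated sets\<close>

lemma Mid_mono: "L \<subseteq> L' \<Longrightarrow> Mid L \<subseteq> Mid L'"
  unfolding Mid_def by blast

text \<open>
  An extreme point of the hull of a mediated set cannot be a midpoint of two distinct
  points of that set, so it is a vertex; a polytope is the hull of its extreme points.
\<close>

lemma mediated_subset_convex_hull:
  assumes "mediated \<Delta> L"
  shows "L \<subseteq> convex hull \<Delta>"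
proof -
  have L: "finite L" "L \<subseteq> Mid L \<union> \<Delta>" using assms by (auto simp: mediated_def)
  have "x \<in> \<Delta>" if x: "x extreme_point_of (convex hull L)" for x
  proof (rule ccontr)
    assume "x \<notin> \<Delta>"
    moreover have "x \<in> L" using x by (rule extreme_point_of_convex_hull)
    ultimately obtain s t where st: "x = midpoint s t" "s \<in> L" "t \<in> L" "s \<noteq> t"
      using L(2) unfolding Mid_def by blast
    have "x \<in> open_segment s t" using st by simp
    moreover have "s \<in> convex hull L" "t \<in> convex hull L" using st(2,3) by (simp_all add: hull_inc)
    ultimately show False using x unfolding extreme_point_of_def by blast
  qed
  then have "convex hull {x. x extreme_point_of (convex hull L)} \<subseteq> convex hull \<Delta>"
    by (intro hull_mono) auto
  then show ?thesis using Krein_Milman_polytope[OF L(1)] hull_subset[of L convex] by blast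
qed

text \<open>
  The union of all mediated sets is mediated: it is finite because the mediated sets lie in a
  bounded region. Hence the definite description denotes this union.
\<close>

lemma max_mediated_greatest:
  fixes \<Delta> :: "(real ^ 'n) set"
  assumes "finite \<Delta>" "\<Delta> \<subseteq> integer_points"
  shows "mediated \<Delta> (max_mediated \<Delta>) \<and> (\<forall>L. mediated \<Delta> L \<longrightarrow> L \<subseteq> max_mediated \<Delta>)"
proof -
  let ?U = "\<Union> {L. mediated \<Delta> L}"
  have "L \<subseteq> convex hull \<Delta> \<inter> integer_points" if "mediated \<Delta> L" for L
    using mediated_subset_convex_hull[OF that] that by (auto simp: mediated_def)
  then have "?U \<subseteq> convex hull \<Delta> \<inter> integer_points" by blast
  moreover have "finite (convex hull \<Delta> \<inter> integer_points)"
    using assms(1) by (intro finite_bounded_integer_points bounded_convex_hull finite_imp_bounded)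
  ultimately have U: "finite ?U" "?U \<subseteq> integer_points" using finite_subset by blast+
  have "mediated \<Delta> \<Delta>" using assms by (auto simp: mediated_def)
  then have "\<Delta> \<subseteq> ?U" by blast
  moreover have "L \<subseteq> Mid ?U \<union> \<Delta>" if "mediated \<Delta> L" for L
    using that Mid_mono[of L ?U] unfolding mediated_def by blast
  ultimately have "mediated \<Delta> ?U" using U unfolding mediated_def by blast
  then have "\<exists>!L. mediated \<Delta> L \<and> (\<forall>L'. mediated \<Delta> L' \<longrightarrow> L' \<subseteq> L)"
    by (intro ex1I[of _ ?U]) blast+
  then show ?thesis unfolding max_mediated_def by (rule theI')
qed

lemma max_mediated_eqI:
  assumes "mediated \<Delta> L" "\<And>L'. mediated \<Delta> L' \<Longrightarrow> L' \<subseteq> L"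
  shows "max_mediated \<Delta> = L"
  unfolding max_mediated_def using assms by (intro the_equality) blast+

text \<open>
  This equality lets a simplicial set be recovered from its maximal mediated set, as the set of
  extreme points of the hull.
\<close>

lemma convex_hull_max_mediated:
  assumes "finite \<Delta>" "\<Delta> \<subseteq> integer_points"
  shows "convex hull (max_mediated \<Delta>) = convex hull \<Delta>"
proof
  have "mediated \<Delta> (max_mediated \<Delta>)" using max_mediated_greatest[OF assms] by blast
  then show "convex hull (max_mediated \<Delta>) \<subseteq> convex hull \<Delta>"
    by (intro hull_minimal mediated_subset_convex_hull) auto
  show "convex hull \<Delta> \<subseteq> convex hull (max_mediated \<Delta>)"
    using \<open>mediated \<Delta> (max_mediated \<Delta>)\<close> by (intro hull_mono) (simp add: mediated_def)
qed

lemma max_mediated_inj: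
  assumes "k_simplicial k \<Delta>" "k_simplicial l \<Delta>'" "max_mediated \<Delta> = max_mediated \<Delta>'"
  shows "\<Delta> = \<Delta>'"
proof -
  have ext: "x \<in> \<Delta> \<longleftrightarrow> x extreme_point_of (convex hull (max_mediated \<Delta>))"
    if "k_simplicial k \<Delta>" for k x and \<Delta> :: "(real ^ 'n) set"
  proof -
    have "\<not> affine_dependent \<Delta>" "finite \<Delta>" "\<Delta> \<subseteq> integer_points"
      using that even_points_subset_integer_points by (auto simp: k_simplicial_def)
    then show ?thesis
      by (simp add: extreme_point_of_convex_hull_affine_independent convex_hull_max_mediated)
  qed
  show ?thesis using ext[OF assms(1)] ext[OF assms(2)] assms(3) by auto
qed

lemma mediated_unimodular_image:
  assumes A: "unimodular A" and "mediated \<Delta> L"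
  shows "mediated ((*v) A ` \<Delta>) ((*v) A ` L)"
proof -
  have L: "finite L" "L \<subseteq> integer_points" "\<Delta> \<subseteq> L" "L \<subseteq> Mid L \<union> \<Delta>"
    using assms(2) by (auto simp: mediated_def)
  have "A *v x \<in> Mid ((*v) A ` L)" if "x \<in> Mid L" for x
  proof -
    obtain s t where st: "x = midpoint s t" "s \<in> L" "t \<in> L" "s \<in> even_points"
      "t \<in> even_points" "s \<noteq> t" using \<open>x \<in> Mid L\<close> unfolding Mid_def by blast
    have "A *v x = midpoint (A *v s) (A *v t)"
      using st(1) by (simp add: midpoint_def matrix_vector_mult_scaleR matrix_vector_right_distrib)
    moreover have "A *v s \<noteq> A *v t" using inj_unimodular[OF A] st(6) by (auto dest: injD)
    moreover have "A *v s \<in> even_points" "A *v t \<in> even_points"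
      using unimodular_image_even_points[OF A] st by blast+
    ultimately show ?thesis using st unfolding Mid_def by blast
  qed
  then show ?thesis using L unimodular_in_integer_points[OF A] unfolding mediated_def by blast
qed

lemma max_mediated_unimodular_image:
  assumes A: "unimodular A" and \<Delta>: "finite \<Delta>" "\<Delta> \<subseteq> integer_points"
  shows "max_mediated ((*v) A ` \<Delta>) = (*v) A ` max_mediated \<Delta>"
proof (rule max_mediated_eqI)
  note max = max_mediated_greatest[OF \<Delta>]
  show "mediated ((*v) A ` \<Delta>) ((*v) A ` max_mediated \<Delta>)"
    using max mediated_unimodular_image[OF A] by blast
  obtain B where B: "unimodular B" "\<And>x. A *v (B *v x) = x" "\<And>x. B *v (A *v x) = x"
    using unimodular_inverse[OF A] by metis
  fix L assume "mediated ((*v) A ` \<Delta>) L"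
  then have "mediated ((*v) B ` (*v) A ` \<Delta>) ((*v) B ` L)"
    by (rule mediated_unimodular_image[OF B(1)])
  then have "(*v) B ` L \<subseteq> max_mediated \<Delta>" using max by (simp add: image_image B)
  then have "(*v) A ` (*v) B ` L \<subseteq> (*v) A ` max_mediated \<Delta>" by (rule image_mono)
  then show "L \<subseteq> (*v) A ` max_mediated \<Delta>" by (simp add: image_image B)
qed

lemma affine_dependent_injective_linear_image:
  fixes f :: "'a::euclidean_space \<Rightarrow> 'b::euclidean_space"
  assumes "linear f" "inj f"
  shows "affine_dependent (f ` S) \<longleftrightarrow> affine_dependent S"
proof -
  have "affine hull (f ` S - {f x}) = f ` (affine hull (S - {x}))" for x
    using affine_hull_linear_image[of f] assms(1) image_set_diff[OF assms(2), of S "{x}"]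
    by (metis image_empty image_insert linear_conv_bounded_linear)
  then show ?thesis by (simp add: affine_dependent_def inj_image_mem_iff[OF assms(2)])
qed

lemma k_simplicial_unimodular_image:
  assumes A: "unimodular A" and "k_simplicial k \<Delta>"
  shows "k_simplicial k ((*v) A ` \<Delta>)"
  using assms(2) inj_unimodular[OF A] unimodular_image_even_points[OF A]
  unfolding k_simplicial_def
  by (auto simp: affine_dependent_injective_linear_image card_image inj_on_subset)

text \<open>
  Integer points, even points, hulls and midpoints are all carried along bijectively by a
  unimodular matrix, so the defining condition on maps of the group holds automatically.
\<close>

lemma unimodular_in_mms_group:
  fixes A :: "real ^ 'n ^ 'n"
  assumes A: "unimodular A"
  shows "(*v) A \<in> mms_group"
proof -
  note inj = inj_unimodular[OF A]
  have preserved: "(\<forall>q \<in> max_mediated ((*v) A ` \<Delta>). \<exists>!p. p \<in> max_mediated \<Delta> \<and> A *v p = q) \<and>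
    (\<forall>q \<in> convex hull ((*v) A ` \<Delta>) \<inter> integer_points.
       \<exists>!p. p \<in> convex hull \<Delta> \<inter> integer_points \<and> A *v p = q)"
    if "k_simplicial k \<Delta>" for k \<Delta>
  proof -
    have "finite \<Delta>" "\<Delta> \<subseteq> integer_points"
      using that even_points_subset_integer_points by (auto simp: k_simplicial_def)
    then have "max_mediated ((*v) A ` \<Delta>) = (*v) A ` max_mediated \<Delta>"
      by (rule max_mediated_unimodular_image[OF A])
    moreover have "convex hull ((*v) A ` \<Delta>) \<inter> integer_points
        = (*v) A ` (convex hull \<Delta> \<inter> integer_points)"
      using A inj by (simp add: image_Int convex_hull_linear_image unimodular_iff_integer_points)
    ultimately show ?thesis by (auto dest: injD[OF inj])
  qed
  then have "mms_preserving ((*v) A)"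
    unfolding mms_preserving_def
    by (intro allI impI conjI[OF k_simplicial_unimodular_image[OF A] preserved])
  moreover have "(0 :: real ^ 'n) \<in> even_points" by (auto simp: even_points_def intro: exI[of _ 0])
  moreover have "(*v) A = (\<lambda>x. A *v x + 0)" by simp
  ultimately show ?thesis using A unfolding mms_group_def by blast
qed

section \<open>Uniqueness of the Hermite normal form\<close>

lemma pivot_column_unique: "pivot H i j \<Longrightarrow> pivot H i j' \<Longrightarrow> j = j'"
  unfolding pivot_def by (metis linorder_neqE_nat)

lemma nonzero_entry_imp_pivot:
  assumes "j < length H" "H ! j $ i \<noteq> 0"
  obtains j' where "j' \<le> j" "pivot H i j'"
proof -
  define j' where "j' = (LEAST j. H ! j $ i \<noteq> 0)"
  have "H ! j' $ i \<noteq> 0" unfolding j'_def using assms(2) by (rule LeastI)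
  moreover have "j' \<le> j" unfolding j'_def using assms(2) by (rule Least_le)
  moreover have "H ! l $ i = 0" if "l < j'" for l
    using not_less_Least that unfolding j'_def by blast
  ultimately have "pivot H i j'" using assms(1) unfolding pivot_def by auto
  then show ?thesis using that \<open>j' \<le> j\<close> by blast
qed

lemma row_hermite_pivot_above:
  assumes "is_row_hermite H" "i < i'" "pivot H i' j'"
  obtains j where "j < j'" "pivot H i j"
  using assms unfolding is_row_hermite_def by blast

lemma row_hermite_pivot_row_unique:
  assumes "is_row_hermite H" "pivot H i j" "pivot H i' j"
  shows "i = i'"
proof (rule ccontr)
  assume "i \<noteq> i'"
  then consider "i < i'" | "i' < i" by fastforce
  then show False
    by cases (metis assms row_hermite_pivot_above pivot_column_unique less_irrefl)+
qed

text \<open>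
  The vector with entries \<open>a \<bullet> H ! j\<close> is the combination of the rows of \<open>H\<close> with
  coefficients \<open>a\<close>. In echelon form its leading entry comes only from the first nonzero row that
  occurs in it, because later rows start further to the right. So pivots and their positions are
  determined by the lattice spanned by the rows.
\<close>

lemma leading_entry_of_row_combination:
  assumes H: "is_row_hermite H" and a: "a \<in> integer_points"
    and j: "j < length H" "a \<bullet> H ! j \<noteq> 0" "\<And>l. l < j \<Longrightarrow> a \<bullet> H ! l = 0"
  obtains i m where "pivot H i j" "m \<in> \<int>" "a \<bullet> H ! j = m * H ! j $ i"
proof -
  define I where "I = {i. a $ i \<noteq> 0 \<and> (\<exists>j. pivot H i j)}"
  have outside: "a $ i * H ! l $ i = 0" if "i \<notin> I" "l < length H" for i l
    using that nonzero_entry_imp_pivot[of l H i] unfolding I_def by fastforce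
  have "I \<noteq> {}"
  proof
    assume "I = {}"
    then have "a $ i * H ! j $ i = 0" for i using outside[of i j] j(1) by simp
    then have "a \<bullet> H ! j = 0" unfolding inner_vec_def inner_real_def by (intro sum.neutral) blast
    then show False using j(2) by simp
  qed
  define i where "i = Min I"
  have "i \<in> I" unfolding i_def using \<open>I \<noteq> {}\<close> by (intro Min_in) auto
  then obtain j0 where j0: "pivot H i j0" and "a $ i \<noteq> 0" by (auto simp: I_def)
  have comb: "a \<bullet> H ! l = a $ i * H ! l $ i" if l: "l \<le> j0" "l < length H" for l
  proof -
    have "a $ i' * H ! l $ i' = 0" if "i' \<noteq> i" for i'
    proof (cases "i' < i")
      case True
      then have "i' \<notin> I" unfolding i_def by (meson Min_le finite_code leD)
      then show ?thesis using outside l(2) by blast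
    next
      case False
      show ?thesis
      proof (rule ccontr)
        assume "\<not> ?thesis"
        then have "H ! l $ i' \<noteq> 0" by auto
        then obtain j2 where j2: "j2 \<le> l" "pivot H i' j2"
          using nonzero_entry_imp_pivot[OF l(2)] by blast
        have "i < i'" using False \<open>i' \<noteq> i\<close> by simp
        then obtain j1 where "j1 < j2" "pivot H i j1"
          using row_hermite_pivot_above[OF H _ j2(2)] by blast
        then show False using pivot_column_unique[OF j0] j2(1) l(1) by fastforce
      qed
    qed
    then have "(\<Sum>i'\<in>UNIV. a $ i' * H ! l $ i') = (\<Sum>i'\<in>{i}. a $ i' * H ! l $ i')"
      by (intro sum.mono_neutral_right) auto
    then show ?thesis by (simp add: inner_vec_def)
  qed
  have len: "j0 < length H" using j0 by (simp add: pivot_def)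
  have "a \<bullet> H ! j0 \<noteq> 0" using comb[OF order.refl len] \<open>a $ i \<noteq> 0\<close> j0 by (simp add: pivot_def)
  moreover have "a \<bullet> H ! l = 0" if "l < j0" for l
    using comb[of l] that len j0 by (simp add: pivot_def)
  ultimately have "j0 = j" using j(2,3) by (metis linorder_neqE_nat)
  moreover have "a $ i \<in> \<int>" using a by (simp add: integer_points_def)
  ultimately show ?thesis using that j0 comb[OF order.refl len] by blast
qed

text \<open>
  A row of \<open>U H\<close> is an integer combination of the rows of \<open>H\<close>, so its leading entry is a
  multiple of the pivot of \<open>H\<close> in that column.
\<close>

lemma pivot_of_unimodular_image:
  assumes H: "is_row_hermite H" and U: "unimodular U" and p: "pivot (map ((*v) U) H) i j"
  obtains i' m where "pivot H i' j" "m \<in> \<int>" "map ((*v) U) H ! j $ i = m * H ! j $ i'"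
proof -
  have len: "j < length H" using p by (simp add: pivot_def)
  have eq: "map ((*v) U) H ! l $ i = U $ i \<bullet> H ! l" if "l < length H" for l
    using that by (simp add: matrix_vector_mul_component)
  have "U $ i \<in> integer_points" using U by (simp add: unimodular_def integer_points_def)
  moreover have "U $ i \<bullet> H ! j \<noteq> 0" using p eq[OF len] by (simp add: pivot_def)
  moreover have "U $ i \<bullet> H ! l = 0" if "l < j" for l
    using p eq[of l] that len by (simp add: pivot_def)
  ultimately obtain i' m where "pivot H i' j" "m \<in> \<int>" "U $ i \<bullet> H ! j = m * H ! j $ i'"
    using leading_entry_of_row_combination[OF H _ len] by blast
  then show ?thesis using that eq[OF len] by metis
qed

lemma positive_mutual_multiples_eq:
  fixes a b :: real
  assumes "a > 0" "b > 0" "m \<in> \<int>" "a = m * b" "m' \<in> \<int>" "b = m' * a"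
  shows "a = b"
proof -
  have "m > 0" "m' > 0" using assms by (metis zero_less_mult_pos2)+
  then have "m \<ge> 1" "m' \<ge> 1"
    using Ints_nonzero_abs_ge1[of m] Ints_nonzero_abs_ge1[of m'] assms(3,5) by simp_all
  then have "m * b \<ge> b" "m' * a \<ge> a" using assms(1,2) by simp_all
  then show ?thesis using assms by linarith
qed

text \<open>
  The columns that contain a pivot agree by the leading entries of the common row lattice. The
  rows agree by induction on the column: rows with a pivot form an initial segment, and if the
  pivot in some column were lower in one matrix than in the other, then the higher row would
  have a pivot in an earlier column, hence in both matrices, and so two pivots in one of them.
\<close>

lemma row_hermite_same_pivots:
  assumes H: "is_row_hermite H" and H': "is_row_hermite H'"
    and U: "unimodular U" "H' = map ((*v) U) H" and V: "unimodular V" "H = map ((*v) V) H'"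
  shows "pivot H i j \<longleftrightarrow> pivot H' i j"
proof (induction j arbitrary: i rule: less_induct)
  case (less j)
  have wlog: "pivot H' i j"
    if H: "is_row_hermite H" and H': "is_row_hermite H'"
      and V: "unimodular V" "H = map ((*v) V) H'"
      and IH: "\<And>j1 i. j1 < j \<Longrightarrow> pivot H i j1 \<longleftrightarrow> pivot H' i j1"
      and p: "pivot H i j" for H H' :: "(real ^ 'n::{finite,linorder}) list" and V i
  proof -
    obtain i' where p': "pivot H' i' j"
      using pivot_of_unimodular_image[OF H' V(1)] p V(2) by metis
    consider "i < i'" | "i' < i" | "i = i'" by fastforce
    then show ?thesis
    proof cases
      case 1
      then obtain j1 where "j1 < j" "pivot H' i j1" using row_hermite_pivot_above[OF H' _ p'] by blast
      then show ?thesis using IH p pivot_column_unique by blast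
    next
      case 2
      then obtain j1 where "j1 < j" "pivot H i' j1" using row_hermite_pivot_above[OF H _ p] by blast
      then show ?thesis using IH p' pivot_column_unique by blast
    next
      case 3
      then show ?thesis using p' by simp
    qed
  qed
  show ?case using wlog[OF H H' V less.IH] wlog[OF H' H U] less.IH by blast
qed

text \<open>
  The difference of two corresponding rows lies in the row lattice, so its leading entry is a
  multiple of a pivot. That pivot lies in a lower row, and the normalisation of the entries
  above a pivot makes the difference too small for a nonzero multiple.
\<close>

lemma row_hermite_unique:
  fixes H H' :: "(real ^ 'n::{finite,linorder}) list"
  assumes H: "is_row_hermite H" and H': "is_row_hermite H'"
    and U: "unimodular U" "H' = map ((*v) U) H"
  shows "H = H'"
proof -
  obtain V where V: "unimodular V" "\<And>x. V *v (U *v x) = x" using unimodular_inverse[OF U(1)] by metis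
  have HV: "H = map ((*v) V) H'" by (simp add: U(2) V(2) comp_def)
  have same: "pivot H i j \<longleftrightarrow> pivot H' i j" for i j
    using row_hermite_same_pivots[OF H H' U V(1) HV] .
  have len: "length H' = length H" using U(2) by simp
  have val: "H ! j $ i = H' ! j $ i" if p: "pivot H i j" for i j
  proof -
    have p': "pivot H' i j" using p same by blast
    obtain i1 m1 where "pivot H i1 j" "m1 \<in> \<int>" "H' ! j $ i = m1 * H ! j $ i1"
      using pivot_of_unimodular_image[OF H U(1)] p' U(2) by metis
    moreover obtain i2 m2 where "pivot H' i2 j" "m2 \<in> \<int>" "H ! j $ i = m2 * H' ! j $ i2"
      using pivot_of_unimodular_image[OF H' V(1)] p HV by metis
    ultimately have "m1 \<in> \<int>" "H' ! j $ i = m1 * H ! j $ i" "m2 \<in> \<int>" "H ! j $ i = m2 * H' ! j $ i"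
      using row_hermite_pivot_row_unique[OF H _ p] row_hermite_pivot_row_unique[OF H' _ p'] by metis+
    moreover have "H ! j $ i > 0" "H' ! j $ i > 0"
      using H H' p p' by (auto simp: is_row_hermite_def)
    ultimately show ?thesis using positive_mutual_multiples_eq by blast
  qed
  have entry: "H ! j $ i = H' ! j $ i" if "j < length H" for i j
  proof (rule ccontr)
    (* The combination of the rows of H with these coefficients is row i of H minus row i of H'. *)
    define a where "a = axis i 1 - U $ i"
    have a: "a \<in> integer_points"
      using U(1) by (auto simp: a_def integer_points_def unimodular_def axis_def)
    have diff: "a \<bullet> H ! l = H ! l $ i - H' ! l $ i" if "l < length H" for l
      using that by (simp add: a_def U(2) inner_diff_left inner_axis' matrix_vector_mul_component)
    assume ne: "H ! j $ i \<noteq> H' ! j $ i"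
    define l where "l = (LEAST l. a \<bullet> H ! l \<noteq> 0)"
    have nej: "a \<bullet> H ! j \<noteq> 0" using ne diff[OF that] by simp
    then have "a \<bullet> H ! l \<noteq> 0" unfolding l_def by (rule LeastI)
    moreover have "l < length H" using Least_le[of "\<lambda>l. a \<bullet> H ! l \<noteq> 0", OF nej] that by (simp add: l_def)
    moreover have "a \<bullet> H ! l' = 0" if "l' < l" for l' using not_less_Least that unfolding l_def by blast
    ultimately obtain i2 m where
      p2: "pivot H i2 l" and m: "m \<in> \<int>" "a \<bullet> H ! l = m * H ! l $ i2"
      and nz: "a \<bullet> H ! l \<noteq> 0" and ll: "l < length H"
      using leading_entry_of_row_combination[OF H a] by metis
    have p2': "pivot H' i2 l" using p2 same by blast
    have "H ! l $ i \<noteq> H' ! l $ i" using nz diff[OF ll] by simp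
    then have "H ! l $ i \<noteq> 0 \<or> H' ! l $ i \<noteq> 0" by auto
    then obtain j0 where j0: "j0 \<le> l" "pivot H i j0"
      using nonzero_entry_imp_pivot[of l H i] nonzero_entry_imp_pivot[of l H' i] ll len same by metis
    have "i \<noteq> i2" using val[OF p2] \<open>H ! l $ i \<noteq> H' ! l $ i\<close> by auto
    moreover have "\<not> i2 < i"
    proof
      assume "i2 < i"
      then obtain j1 where "j1 < j0" "pivot H i2 j1" using row_hermite_pivot_above[OF H _ j0(2)] by blast
      then show False using pivot_column_unique[OF p2] j0(1) by fastforce
    qed
    ultimately have "i < i2" by simp
    then have "0 \<le> H ! l $ i" "H ! l $ i < H ! l $ i2" "0 \<le> H' ! l $ i" "H' ! l $ i < H' ! l $ i2"
      using H H' p2 p2' unfolding is_row_hermite_def by blast+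
    then have "\<bar>a \<bullet> H ! l\<bar> < H ! l $ i2" "H ! l $ i2 > 0" using diff[OF ll] val[OF p2] by auto
    then have "\<bar>m\<bar> < 1" using m(2) by (simp add: abs_mult)
    then have "m = 0" using m(1) by (auto elim!: Ints_cases)
    then show False using m(2) nz by simp
  qed
  show ?thesis using entry len by (intro nth_equalityI) (auto simp: vec_eq_iff)
qed

section \<open>Existence of the Hermite normal form\<close>

lemma unimodular_row_addition:
  fixes w :: "real ^ 'n"
  assumes "w \<in> integer_points" "w $ r = 0"
  obtains U where "unimodular U" "\<And>x. U *v x = x + x $ r *\<^sub>R w"
proof (rule obtain_unimodular[of "\<lambda>x. x + x $ r *\<^sub>R w" "\<lambda>x. x - x $ r *\<^sub>R w"])
  show "linear (\<lambda>x. x + x $ r *\<^sub>R w)" by (intro linearI) (auto simp: algebra_simps)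
qed (use assms in \<open>auto simp: integer_points_def\<close>)

lemma unimodular_signed_involution:
  fixes p :: "'n::finite \<Rightarrow> 'n" and s :: "'n \<Rightarrow> real"
  assumes p: "\<And>i. p (p i) = i" and s: "\<And>i. s i = 1 \<or> s i = -1"
  obtains U where "unimodular U" "\<And>x i. (U *v x) $ i = s i * x $ p i"
proof -
  have "s i * s i = 1" "s i \<in> \<int>" for i using s[of i] by auto
  note s2 = this
  let ?f = "\<lambda>x :: real ^ 'n. \<chi> i. s i * x $ p i" and ?g = "\<lambda>x :: real ^ 'n. \<chi> i. s (p i) * x $ p i"
  show ?thesis
  proof (rule obtain_unimodular[of ?f ?g])
    show "linear ?f" by (intro linearI) (simp_all add: vec_eq_iff algebra_simps)
    show "?f (?g x) = x" for x by (simp add: vec_eq_iff p s2(1) flip: mult.assoc)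
    show "?f x \<in> integer_points" "?g x \<in> integer_points" if "x \<in> integer_points" for x
      using that s2(2) by (simp_all add: integer_points_def)
  qed (use that in auto)
qed

text \<open>
  Euclid's algorithm on the entries of one column in the rows \<open>S\<close>. While two of these entries
  are nonzero, adding or subtracting the row of the smaller one lowers the sum of absolute
  values by at least one; the single remaining entry is then moved to row \<open>r\<close> and made
  nonnegative. Columns that vanish on \<open>S\<close> are fixed, which protects the columns that are already
  in normal form.
\<close>

lemma unimodular_clear_column:
  fixes c :: "real ^ 'n"
  assumes "c \<in> integer_points" "r \<in> S"
  shows "\<exists>U. unimodular U \<and> (\<forall>x. (\<forall>i\<in>S. x $ i = 0) \<longrightarrow> U *v x = x) \<and>
    (U *v c) $ r \<ge> 0 \<and> (\<forall>i\<in>S. i \<noteq> r \<longrightarrow> (U *v c) $ i = 0)"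
proof -
  define good where "good U c \<longleftrightarrow> unimodular U \<and> (\<forall>x. (\<forall>i\<in>S. x $ i = 0) \<longrightarrow> U *v x = x) \<and>
     (U *v c) $ r \<ge> 0 \<and> (\<forall>i\<in>S. i \<noteq> r \<longrightarrow> (U *v c) $ i = 0)" for U and c :: "real ^ 'n"
  have "\<exists>U. good U c" if "c \<in> integer_points" "(\<Sum>i\<in>S. \<bar>c $ i\<bar>) \<le> real N" for c N
    using that
  proof (induction N arbitrary: c rule: less_induct)
    case (less N)
    show ?case
    proof (cases "\<exists>i\<in>S. \<exists>i'\<in>S. i \<noteq> i' \<and> c $ i \<noteq> 0 \<and> c $ i' \<noteq> 0")
      case True
      then obtain i i' where i: "i \<in> S" "i' \<in> S" "i \<noteq> i'" "c $ i \<noteq> 0" "c $ i' \<noteq> 0"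
        and le: "\<bar>c $ i'\<bar> \<le> \<bar>c $ i\<bar>" by (metis linorder_le_cases)
      (* With this sign, adding the multiple a of row i' brings entry i closer to zero. *)
      define a where "a = - (sgn (c $ i) * sgn (c $ i'))"
      have "a \<in> \<int>" by (auto simp: a_def sgn_if)
      then obtain E where E: "unimodular E" "\<And>x. E *v x = x + x $ i' *\<^sub>R (a *\<^sub>R axis i 1)"
        using unimodular_row_addition[of "a *\<^sub>R axis i 1" i'] i(3)
        by (auto simp: integer_points_def axis_def)
      have new: "(E *v c) $ i = c $ i + a * c $ i'" and old: "l \<noteq> i \<Longrightarrow> (E *v c) $ l = c $ l" for l
        by (simp_all add: E(2) axis_def)
      have "\<bar>c $ i + a * c $ i'\<bar> = \<bar>c $ i\<bar> - \<bar>c $ i'\<bar>"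
        using le i(4,5) by (auto simp: a_def sgn_if abs_if split: if_splits)
      moreover have one: "\<bar>c $ i'\<bar> \<ge> 1"
        using less.prems(1) i(5) by (intro Ints_nonzero_abs_ge1) (auto simp: integer_points_def)
      ultimately have dec: "\<bar>(E *v c) $ i\<bar> \<le> \<bar>c $ i\<bar> - 1" using new by simp
      have "(\<Sum>l\<in>S. \<bar>(E *v c) $ l\<bar>) = \<bar>(E *v c) $ i\<bar> + (\<Sum>l\<in>S - {i}. \<bar>(E *v c) $ l\<bar>)"
        using i(1) by (simp add: sum.remove)
      also have "(\<Sum>l\<in>S - {i}. \<bar>(E *v c) $ l\<bar>) = (\<Sum>l\<in>S - {i}. \<bar>c $ l\<bar>)"
        using old by (intro sum.cong) auto
      also have "\<bar>(E *v c) $ i\<bar> + \<dots> \<le> (\<Sum>l\<in>S. \<bar>c $ l\<bar>) - 1"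
        using dec i(1) by (simp add: sum.remove[of S i])
      finally have sum: "(\<Sum>l\<in>S. \<bar>(E *v c) $ l\<bar>) \<le> real N - 1" using less.prems(2) by linarith
      have "0 \<le> (\<Sum>l\<in>S. \<bar>(E *v c) $ l\<bar>)" by (simp add: sum_nonneg)
      then have "N \<ge> 1" using sum by linarith
      then obtain U where U: "good U (E *v c)"
        using less.IH[of "N - 1" "E *v c"] sum unimodular_in_integer_points[OF E(1) less.prems(1)]
        by (auto simp: of_nat_diff)
      have "E *v x = x" if "\<forall>i\<in>S. x $ i = 0" for x using E(2) that i(2) by simp
      then have "good (U ** E) c"
        using U E(1) unfolding good_def
        by (auto simp: unimodular_mult simp flip: matrix_vector_mul_assoc)
      then show ?thesis by blast
    next
      case False
      show ?thesis
      proof (cases "\<exists>q\<in>S. c $ q \<noteq> 0")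
        case True
        then obtain q where q: "q \<in> S" "c $ q \<noteq> 0" by blast
        have zero: "c $ i = 0" if "i \<in> S" "i \<noteq> q" for i using False that q by blast
        define s :: "'n \<Rightarrow> real" where "s i = (if i = r then sgn (c $ q) else 1)" for i
        have "s i = 1 \<or> s i = -1" for i using q(2) by (simp add: s_def sgn_if)
        then obtain U where U: "unimodular U"
          "\<And>x i. (U *v x) $ i = s i * x $ Transposition.transpose r q i"
          using unimodular_signed_involution[of "Transposition.transpose r q" s,
              OF transpose_involutory] by metis
        have "U *v x = x" if "\<forall>i\<in>S. x $ i = 0" for x
          using that \<open>r \<in> S\<close> q(1) by (auto simp: vec_eq_iff U(2) s_def Transposition.transpose_def)
        moreover have "(U *v c) $ r \<ge> 0" by (simp add: U(2) s_def sgn_if)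
        moreover have "(U *v c) $ i = 0" if "i \<in> S" "i \<noteq> r" for i
          using that zero \<open>r \<in> S\<close> by (auto simp: U(2) s_def Transposition.transpose_def)
        ultimately have "good U c" using U(1) by (simp add: good_def)
        then show ?thesis by blast
      next
        case False
        then have "good (mat 1) c" using \<open>r \<in> S\<close> by (simp add: good_def unimodular_mat_1)
        then show ?thesis by blast
      qed
    qed
  qed
  moreover obtain N :: nat where "(\<Sum>i\<in>S. \<bar>c $ i\<bar>) \<le> real N" using real_arch_simple by blast
  ultimately obtain U where "good U c" using assms(1) by blast
  then show ?thesis unfolding good_def by blast
qed

lemma pivot_snoc:
  "pivot (H @ [c]) i j \<longleftrightarrow>
     pivot H i j \<or> (j = length H \<and> c $ i \<noteq> 0 \<and> (\<forall>l<length H. H ! l $ i = 0))"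
  by (auto simp: pivot_def nth_append less_Suc_eq)

text \<open>
  Appending a column needs changes only in the rows that vanish so far: one Euclidean
  reduction there leaves at most one new pivot, at the top of these rows. Multiples of its row
  then reduce the entries above it, without effect on the earlier columns.
\<close>

lemma row_hermite_append_column:
  fixes H :: "(real ^ 'n::{finite,linorder}) list"
  assumes H: "is_row_hermite H" and c: "c \<in> integer_points"
  obtains U where "unimodular U" "map ((*v) U) H = H" "is_row_hermite (H @ [U *v c])"
proof -
  define S where "S = {i. \<forall>l<length H. H ! l $ i = 0}"
  have inS: "i \<in> S \<longleftrightarrow> (\<nexists>j. pivot H i j)" for i
  proof
    show "i \<in> S \<Longrightarrow> \<nexists>j. pivot H i j" by (auto simp: S_def pivot_def)
    show "\<nexists>j. pivot H i j \<Longrightarrow> i \<in> S" unfolding S_def using nonzero_entry_imp_pivot by blast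
  qed
  have piv: "pivot (H @ [c']) i j \<longleftrightarrow> pivot H i j \<or> (j = length H \<and> i \<in> S \<and> c' $ i \<noteq> 0)" for c' i j
    by (auto simp: pivot_snoc S_def)
  have H_int: "set H \<subseteq> integer_points" using H by (simp add: is_row_hermite_def)
  have fix_H: "map ((*v) U) H = H" if "\<And>x. \<forall>i\<in>S. x $ i = 0 \<Longrightarrow> U *v x = x" for U
    using that by (intro map_idI) (auto simp: S_def in_set_conv_nth)
  have vanishing: "is_row_hermite (H @ [c'])"
    if "c' \<in> integer_points" "\<And>i. i \<in> S \<Longrightarrow> c' $ i = 0" for c'
  proof -
    have "pivot (H @ [c']) i j \<longleftrightarrow> pivot H i j" for i j using piv that(2) by blast
    moreover have "pivot H i j \<Longrightarrow> (H @ [c']) ! j = H ! j" for i j by (simp add: pivot_def nth_append)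
    ultimately show ?thesis using H that(1) unfolding is_row_hermite_def by auto
  qed
  show ?thesis
  proof (cases "S = {}")
    case True
    then show ?thesis using that[OF unimodular_mat_1 fix_H] vanishing c by simp
  next
    case False
    define r where "r = Min S"
    have r: "r \<in> S" unfolding r_def using False by (intro Min_in) auto
    have above: "\<exists>j<length H. pivot H i j" if "i < r" for i
    proof -
      have "i \<notin> S" using that unfolding r_def by (meson Min_le finite_code leD)
      then show ?thesis using inS by (auto simp: pivot_def)
    qed
    obtain U where U: "unimodular U" "\<And>x. \<forall>i\<in>S. x $ i = 0 \<Longrightarrow> U *v x = x"
      and Ur: "(U *v c) $ r \<ge> 0" and US: "\<And>i. i \<in> S \<Longrightarrow> i \<noteq> r \<Longrightarrow> (U *v c) $ i = 0"
      using unimodular_clear_column[OF c r] by blast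
    have Uc: "U *v c \<in> integer_points" by (rule unimodular_in_integer_points[OF U(1) c])
    show ?thesis
    proof (cases "(U *v c) $ r = 0")
      case True
      then have "is_row_hermite (H @ [U *v c])" using US by (intro vanishing[OF Uc]) metis
      then show ?thesis using that[OF U(1) fix_H] U(2) by blast
    next
      case False
      define d where "d = (U *v c) $ r"
      have d: "d > 0" using False Ur by (simp add: d_def)
      (* These quotients vanish in the rows below r, where the column is already zero. *)
      define w where "w = (\<chi> i. if i = r then 0 else - real_of_int \<lfloor>(U *v c) $ i / d\<rfloor>)"
      have "w \<in> integer_points" "w $ r = 0" by (auto simp: w_def integer_points_def)
      then obtain E where E: "unimodular E" "\<And>x. E *v x = x + x $ r *\<^sub>R w"
        using unimodular_row_addition by blast
      define c2 where "c2 = (E ** U) *v c"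
      have c2_eq: "c2 = U *v c + d *\<^sub>R w"
        by (simp add: c2_def E(2) d_def flip: matrix_vector_mul_assoc)
      have c2_r: "c2 $ r = d" by (simp add: c2_eq w_def d_def)
      have c2_S: "c2 $ i = 0" if "i \<in> S" "i \<noteq> r" for i using that US by (simp add: c2_eq w_def)
      have c2_red: "0 \<le> c2 $ i" "c2 $ i < d" if "i \<noteq> r" for i
      proof -
        have "c2 $ i = d * frac ((U *v c) $ i / d)"
          using that d by (simp add: c2_eq w_def frac_def field_simps)
        then show "0 \<le> c2 $ i" "c2 $ i < d" using d frac_lt_1 by simp_all
      qed
      have EU: "unimodular (E ** U)" using E(1) U(1) by (rule unimodular_mult)
      have c2_int: "c2 \<in> integer_points"
        unfolding c2_def by (rule unimodular_in_integer_points[OF EU c])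
      have "(E ** U) *v x = x" if "\<forall>i\<in>S. x $ i = 0" for x
        using U(2)[OF that] that r by (simp add: E(2) flip: matrix_vector_mul_assoc)
      then have fixed: "map ((*v) (E ** U)) H = H" by (rule fix_H)
      have piv2: "pivot (H @ [c2]) i j \<longleftrightarrow> pivot H i j \<or> (j = length H \<and> i = r)" for i j
        using piv c2_S c2_r r d by (metis less_irrefl)
      have "is_row_hermite (H @ [c2])"
        unfolding is_row_hermite_def
      proof (intro conjI allI impI)
        show "set (H @ [c2]) \<subseteq> integer_points" using H_int c2_int by simp
      next
        fix i i' j' assume "i < i' \<and> pivot (H @ [c2]) i' j'"
        then show "\<exists>j<j'. pivot (H @ [c2]) i j"
          unfolding piv2 using row_hermite_pivot_above[OF H] above by metis
      next
        fix i j assume "pivot (H @ [c2]) i j"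
        then consider "pivot H i j" "(H @ [c2]) ! j = H ! j" | "i = r" "(H @ [c2]) ! j = c2"
          unfolding piv2 by (auto simp: pivot_def nth_append)
        note cases = this
        show "(H @ [c2]) ! j $ i > 0"
          using cases H d c2_r by cases (auto simp: is_row_hermite_def)
        fix i' assume "i' < i"
        show "0 \<le> (H @ [c2]) ! j $ i'" "(H @ [c2]) ! j $ i' < (H @ [c2]) ! j $ i"
          using cases \<open>i' < i\<close> H c2_red[of i'] c2_r by (cases; auto simp: is_row_hermite_def)+
      qed
      then show ?thesis using that[OF EU fixed] by (simp add: c2_def)
    qed
  qed
qed

lemma row_hermite_exists:
  fixes M :: "(real ^ 'n::{finite,linorder}) list"
  assumes "set M \<subseteq> integer_points"
  shows "\<exists>U. unimodular U \<and> is_row_hermite (map ((*v) U) M)"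
  using assms
proof (induction M rule: rev_induct)
  case Nil
  show ?case using unimodular_mat_1 by (auto simp: is_row_hermite_def pivot_def)
next
  case (snoc c M)
  then obtain U where U: "unimodular U" "is_row_hermite (map ((*v) U) M)" by auto
  have "U *v c \<in> integer_points" using snoc.prems unimodular_in_integer_points[OF U(1)] by simp
  then obtain E where E: "unimodular E" "map ((*v) E) (map ((*v) U) M) = map ((*v) U) M"
      "is_row_hermite (map ((*v) U) M @ [E *v (U *v c)])"
    using row_hermite_append_column[OF U(2)] by blast
  have "map ((*v) (E ** U)) (M @ [c]) = map ((*v) U) M @ [E *v (U *v c)]"
    using E(2) by (simp flip: matrix_vector_mul_assoc)
  then have "is_row_hermite (map ((*v) (E ** U)) (M @ [c]))" using E(3) by metis
  then show ?case using unimodular_mult[OF E(1) U(1)] by blast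
qed

section \<open>The Hermite normal form as a complete invariant\<close>

lemma hermite_normal_form_unimodular_image:
  assumes "unimodular A"
  shows "hermite_normal_form (map ((*v) A) M) = hermite_normal_form M"
proof -
  obtain B where B: "unimodular B" "\<And>x. B *v (A *v x) = x"
    using unimodular_inverse[OF assms] by metis
  have "(\<exists>U. unimodular U \<and> H = map ((*v) U) (map ((*v) A) M)) \<longleftrightarrow>
        (\<exists>U. unimodular U \<and> H = map ((*v) U) M)" for H
  proof
    assume "\<exists>U. unimodular U \<and> H = map ((*v) U) (map ((*v) A) M)"
    then obtain U where "unimodular U" "H = map ((*v) (U ** A)) M"
      by (auto simp: comp_def matrix_vector_mul_assoc)
    then show "\<exists>U. unimodular U \<and> H = map ((*v) U) M" using unimodular_mult assms by blast
  next
    assume "\<exists>U. unimodular U \<and> H = map ((*v) U) M"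
    then obtain U where "unimodular U" "H = map ((*v) (U ** B)) (map ((*v) A) M)"
      by (auto simp: comp_def B(2) simp flip: matrix_vector_mul_assoc)
    then show "\<exists>U. unimodular U \<and> H = map ((*v) U) (map ((*v) A) M)"
      using unimodular_mult B(1) by blast
  qed
  then show ?thesis unfolding hermite_normal_form_def by simp
qed

lemma hermite_normal_form_eq_unimodular_image:
  assumes "set M \<subseteq> integer_points"
  obtains U where "unimodular U" "hermite_normal_form M = map ((*v) U) M"
proof -
  let ?P = "\<lambda>H. is_row_hermite H \<and> (\<exists>U. unimodular U \<and> H = map ((*v) U) M)"
  have "H = H'" if P: "?P H" "?P H'" for H H'
  proof -
    obtain U U' where U: "unimodular U" "H = map ((*v) U) M" "unimodular U'" "H' = map ((*v) U') M"
      using P by blast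
    obtain V where V: "unimodular V" "\<And>x. V *v (U *v x) = x"
      using unimodular_inverse[OF U(1)] by metis
    have "H' = map ((*v) (U' ** V)) H"
      by (simp add: U comp_def V(2) flip: matrix_vector_mul_assoc)
    then show ?thesis using row_hermite_unique P unimodular_mult[OF U(3) V(1)] by blast
  qed
  moreover have "\<exists>H. ?P H" using row_hermite_exists[OF assms] by blast
  ultimately have "\<exists>!H. ?P H" by blast
  then have "?P (hermite_normal_form M)" unfolding hermite_normal_form_def by (rule theI')
  then show ?thesis using that by blast
qed

lemma hermite_normal_form_eq_iff:
  assumes "set M \<subseteq> integer_points" "set N \<subseteq> integer_points"
  shows "hermite_normal_form M = hermite_normal_form N \<longleftrightarrow>
    (\<exists>A. unimodular A \<and> map ((*v) A) M = N)"
proof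
  assume eq: "hermite_normal_form M = hermite_normal_form N"
  obtain U where U: "unimodular U" "hermite_normal_form M = map ((*v) U) M"
    using hermite_normal_form_eq_unimodular_image[OF assms(1)] .
  obtain V where V: "unimodular V" "hermite_normal_form N = map ((*v) V) N"
    using hermite_normal_form_eq_unimodular_image[OF assms(2)] .
  obtain W where W: "unimodular W" "\<And>x. W *v (V *v x) = x"
    using unimodular_inverse[OF V(1)] by metis
  have "map ((*v) (W ** U)) M = map ((*v) W) (map ((*v) U) M)"
    by (simp add: comp_def flip: matrix_vector_mul_assoc)
  also have "\<dots> = map ((*v) W) (map ((*v) V) N)" using eq U(2) V(2) by simp
  also have "\<dots> = N" by (simp add: comp_def W(2))
  finally show "\<exists>A. unimodular A \<and> map ((*v) A) M = N" using unimodular_mult[OF W(1) U(1)] by blast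
qed (auto simp: hermite_normal_form_unimodular_image)

theorem corollary3p6:
  fixes k :: nat and vs us :: "(real ^ 'n::{finite,linorder}) list"
  assumes "length vs = k" and "length us = k"
    and "k_simplicial k (insert 0 (set vs))"
    and "k_simplicial k (insert 0 (set us))"
  shows "(\<exists>T \<in> mms_group. translation_part T = 0 \<and>
            max_mediated (T ` insert 0 (set vs)) = max_mediated (insert 0 (set us))) \<longleftrightarrow>
         (\<exists>\<pi>. \<pi> permutes {..<k} \<and>
            hermite_normal_form (permute_list \<pi> vs) = hermite_normal_form us)"
proof -
  (* The vertex 0 and the k list entries make k + 1 points, so that there is no repetition. *)
  have vertices: "distinct xs \<and> 0 \<notin> set xs \<and> set xs \<subseteq> integer_points"
    if "length xs = k" "k_simplicial k (insert 0 (set xs))" for xs :: "(real ^ 'n::{finite,linorder}) list"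
  proof -
    have "card (insert 0 (set xs)) = k + 1" "insert 0 (set xs) \<subseteq> even_points"
      using that(2) by (auto simp: k_simplicial_def)
    moreover have "card (set xs) \<le> k" using that(1) card_length by blast
    ultimately show ?thesis
      using that(1) even_points_subset_integer_points
      by (auto simp: card_insert_if card_distinct split: if_splits)
  qed
  have vs: "distinct vs" "0 \<notin> set vs" "set vs \<subseteq> integer_points"
    and us: "distinct us" "0 \<notin> set us" "set us \<subseteq> integer_points"
    using vertices assms by blast+
  have image_eq_iff: "(*v) A ` insert 0 (set vs) = insert 0 (set us) \<longleftrightarrow>
      (\<exists>\<pi>. \<pi> permutes {..<k} \<and> map ((*v) A) (permute_list \<pi> vs) = us)"
    if A: "unimodular A" for A
  proof -
    have inj: "inj ((*v) A)" by (rule inj_unimodular[OF A])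
    have "0 \<notin> (*v) A ` set vs" using vs(2) injD[OF inj, of _ 0] by force
    then have "(*v) A ` insert 0 (set vs) = insert 0 (set us) \<longleftrightarrow> set (map ((*v) A) vs) = set us"
      using us(2) by (auto simp: insert_ident)
    also have "\<dots> \<longleftrightarrow> mset us = mset (map ((*v) A) vs)"
      using vs(1) us(1) inj
      by (metis set_eq_iff_mset_eq_distinct distinct_map inj_on_subset subset_UNIV)
    also have "\<dots> \<longleftrightarrow> (\<exists>\<pi>. \<pi> permutes {..<k} \<and> permute_list \<pi> (map ((*v) A) vs) = us)"
      using assms(1) by (metis mset_eq_permutation mset_permute_list length_map)
    also have "\<dots> \<longleftrightarrow> (\<exists>\<pi>. \<pi> permutes {..<k} \<and> map ((*v) A) (permute_list \<pi> vs) = us)"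
      using assms(1) by (metis permute_list_map)
    finally show ?thesis .
  qed
  have "(\<exists>T \<in> mms_group. translation_part T = 0 \<and>
          max_mediated (T ` insert 0 (set vs)) = max_mediated (insert 0 (set us))) \<longleftrightarrow>
        (\<exists>A. unimodular A \<and> (*v) A ` insert 0 (set vs) = insert 0 (set us))"
  proof
    assume "\<exists>T \<in> mms_group. translation_part T = 0 \<and>
          max_mediated (T ` insert 0 (set vs)) = max_mediated (insert 0 (set us))"
    then obtain A b where A: "unimodular A" and b: "translation_part (\<lambda>x. A *v x + b) = 0"
      and max: "max_mediated ((\<lambda>x. A *v x + b) ` insert 0 (set vs)) = max_mediated (insert 0 (set us))"
      unfolding mms_group_def by blast
    have "b = 0" using b by (simp add: translation_part_def)
    then have "max_mediated ((*v) A ` insert 0 (set vs)) = max_mediated (insert 0 (set us))"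
      using max by simp
    then show "\<exists>A. unimodular A \<and> (*v) A ` insert 0 (set vs) = insert 0 (set us)"
      using max_mediated_inj k_simplicial_unimodular_image[OF A assms(3)] assms(4) A by blast
  next
    assume "\<exists>A. unimodular A \<and> (*v) A ` insert 0 (set vs) = insert 0 (set us)"
    then obtain A where A: "unimodular A" "(*v) A ` insert 0 (set vs) = insert 0 (set us)" by blast
    have "translation_part ((*v) A) = 0" by (simp add: translation_part_def)
    then show "\<exists>T \<in> mms_group. translation_part T = 0 \<and>
          max_mediated (T ` insert 0 (set vs)) = max_mediated (insert 0 (set us))"
      using unimodular_in_mms_group[OF A(1)] A(2) by (intro bexI[of _ "(*v) A"]) auto
  qed
  also have "\<dots> \<longleftrightarrow> (\<exists>A. unimodular A \<and>
      (\<exists>\<pi>. \<pi> permutes {..<k} \<and> map ((*v) A) (permute_list \<pi> vs) = us))"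
    by (intro ex_cong1 conj_cong refl image_eq_iff)
  also have "\<dots> \<longleftrightarrow> (\<exists>\<pi>. \<pi> permutes {..<k} \<and>
      (\<exists>A. unimodular A \<and> map ((*v) A) (permute_list \<pi> vs) = us))"
    by blast
  also have "\<dots> \<longleftrightarrow> (\<exists>\<pi>. \<pi> permutes {..<k} \<and>
      hermite_normal_form (permute_list \<pi> vs) = hermite_normal_form us)"
    using vs(3) us(3) assms(1)
    by (intro ex_cong1 conj_cong refl hermite_normal_form_eq_iff[symmetric]) simp_all
  finally show ?thesis .
qed

end
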